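(* Let $(x_k)$ be generated by the inexact proximal-gradient iteration $x_{k+1}=\operatorname{prox}_{1/L}\{x_k-\tfrac1L(\nabla f(x_k)+e_k)\}$ described in the context. Suppose that for each $\beta\in(0,1)$, $$U_k\le\lambda\beta^k$$ for some constant $\lambda>0$ and for all $k$, and that the errors satisfy the exponential tail condition $$\Pr\big([e_k]_i\ge\epsilon\mid\mathcal F_{k-1}\big)\le\exp(-\epsilon^2/U_k)$$ for each component $i$. Then: (1) Take $k$ fixed. For all $A>0$ there exists a constant $C_A>0$ such that $$\Pr(\pi_k-\rho^k\pi_0\ge\epsilon)\le C_A\,\epsilon^{-A}.$$ (2) Take $\epsilon$ fixed. For all $A>0$ there exists a constant $C_A>0$ such that $$\Pr(\pi_k-\rho^k\pi_0\ge\epsilon)\le C_A\,A^{-k}.$$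
   Context: Setting. $f:\mathbb R^n\to\mathbb R$ is differentiable, $g:\mathbb R^n\to(-\infty,+\infty]$ is convex and lower semicontinuous, $h:=f+g$, and the solution set $\mathcal S:=\arg\min h$ is nonempty. $\|\cdot\|$ is the Euclidean norm. For $\alpha>0$, $\operatorname{prox}_\alpha\{z\}:=\arg\min_y\{\alpha g(y)+\tfrac12\|z-y\|^2\}$. There are constants $L>0$ and $\tau\ge 1$ such that for all $x,y\in\mathbb R^n$: $\|\nabla f(y)-\nabla f(x)\|\le L\|y-x\|$, and $\min_{\bar x\in\mathcal S}\|x-\bar x\|\le\tau\,\|x-\operatorname{prox}_{1/L}\{x-\tfrac1L\nabla f(x)\}\|$. The errors $e_k$ ($k\ge 0$) are random vectors in $\mathbb R^n$; $[e_k]_i$ is the $i$th component of $e_k$. The $U_k$ are real numbers bounding the size of the errors. The optimality gap is $\pi_k:=h(x_k)-\inf h$. $\mathcal F_k$ is the $\sigma$-algebra generated by $e_0,\dots,e_k$ (and $\mathcal F_{-1}$ is trivial). Constant: $\rho:=\frac{40\tau^2}{1+40\tau^2}$.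
   Formalization: The exponential tail condition is imposed for ε>0 on both [e_k]_i and −[e_k]_i, since with only the printed upper tail the claim fails (f=x²/2, g=0, e_k=−1); also U_k>0, h(x_0) is finite, x_0 is deterministic, and λ may depend on β. *)

theory Defs
  imports "HOL-Probability.Probability"
begin

definition convex_ereal :: "('a::real_vector \<Rightarrow> ereal) \<Rightarrow> bool" where
  "convex_ereal g \<longleftrightarrow>
     (\<forall>x y t. 0 \<le> t \<and> t \<le> 1 \<longrightarrow>
        g ((1 - t) *\<^sub>R x + t *\<^sub>R y) \<le> ereal (1 - t) * g x + ereal t * g y)"

definition lower_semicont :: "('a::topological_space \<Rightarrow> ereal) \<Rightarrow> bool" where
  "lower_semicont g \<longleftrightarrow> (\<forall>x. g x \<le> Liminf (at x) g)"

definition objective :: "('a \<Rightarrow> real) \<Rightarrow> ('a \<Rightarrow> ereal) \<Rightarrow> 'a \<Rightarrow> ereal" where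
  "objective f g x = ereal (f x) + g x"

definition argmin_set :: "('a \<Rightarrow> ereal) \<Rightarrow> 'a set" where
  "argmin_set h = {x. is_arg_min h (\<lambda>_. True) x}"

(* For proper, convex, lower semicontinuous g and \<alpha> > 0 the minimiser exists and is unique,
   so the choice made by arg_min is immaterial. *)
definition prox :: "('a::real_normed_vector \<Rightarrow> ereal) \<Rightarrow> real \<Rightarrow> 'a \<Rightarrow> 'a" where
  "prox g \<alpha> z = arg_min (\<lambda>y. ereal \<alpha> * g y + ereal ((norm (z - y))\<^sup>2 / 2)) (\<lambda>_. True)"

definition opt_gap :: "('a \<Rightarrow> ereal) \<Rightarrow> 'a \<Rightarrow> ereal" where
  "opt_gap h x = h x - (INF y. h y)"

definition rate :: "real \<Rightarrow> real" where
  "rate \<tau> = 40 * \<tau>\<^sup>2 / (1 + 40 * \<tau>\<^sup>2)"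

(* The sigma-algebra generated by e 0, ..., e (k - 1), i.e. F_{k-1}: the index is shifted by one,
   and k = 0 gives the trivial sigma-algebra F_{-1}. *)
definition past :: "'w measure \<Rightarrow> (nat \<Rightarrow> 'w \<Rightarrow> 'v::topological_space) \<Rightarrow> nat \<Rightarrow> 'w measure" where
  "past M e k = sigma (space M) {e j -` B \<inter> space M | j B. j < k \<and> B \<in> sets borel}"

(* Conditional probability of an event given a sub-sigma-algebra F of M; a version, hence only
   determined almost everywhere. *)
definition cond_prob_given :: "'w measure \<Rightarrow> 'w measure \<Rightarrow> ('w \<Rightarrow> bool) \<Rightarrow> 'w \<Rightarrow> real" where
  "cond_prob_given M F P = real_cond_exp M F (indicat_real {\<omega> \<in> space M. P \<omega>})"

end

theory Submission
  imports Defs "HOL-Real_Asymp.Real_Asymp"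
begin

text \<open>
  Strong convexity of the proximal subproblem at the current iterate gives a decrease of the objective
  proportional to the squared step, up to \<open>norm e\<^sup>2\<close>; the same inequality at the minimisers bounds the
  new gap by the squared distance to the solution set, which the error bound and nonexpansiveness of
  the prox turn into the squared step again. Combining the two, the gap contracts by the factor
  \<open>rate \<tau>\<close> up to \<open>2 / L * norm e\<^sup>2\<close>, so the excess at step \<open>k\<close> is at most a weighted sum of the
  squared errors.

  For that sum a union bound over the \<open>k\<close> errors and their components suffices, and only the
  unconditional tails matter. Choosing \<open>\<beta> = rate \<tau>\<close> in the decay hypothesis makes every weighted
  summand have scale \<open>rate \<tau> ^ k\<close>, so the excess exceeds \<open>\<epsilon>\<close> with probability
  \<open>O(k) * exp (- const * \<epsilon> / (k * rate \<tau> ^ k))\<close>: exponentially small in \<open>\<epsilon>\<close> and doubly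
  exponentially small in \<open>k\<close>.
\<close>

section \<open>Lower semicontinuity and attainment of minima\<close>

lemma open_superlevel_lower_semicont:
  assumes "lower_semicont g"
  shows "open {y. c < g y}"
proof (subst open_subopen, intro ballI)
  fix y assume y: "y \<in> {y. c < g y}"
  then have "c < Liminf (at y) g"
    using assms unfolding lower_semicont_def by (auto intro: less_le_trans)
  \<comment> \<open>The filter \<open>at y\<close> leaves out the point itself;
    \<open>c < g y\<close> supplies it and turns the punctured neighbourhood into a full
    one.\<close>
  then have "eventually (\<lambda>z. c < g z) (nhds y)"
    using y by (auto simp: eventually_nhds_conv_at dest: less_LiminfD)
  then show "\<exists>T. open T \<and> y \<in> T \<and> T \<subseteq> {y. c < g y}"
    unfolding eventually_nhds by blast
qed

text \<open>For finite \<open>c\<close>, a real \<open>t\<close> strictly between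
  \<open>(c - q y) / \<alpha>\<close> and \<open>g y\<close> splits the condition into an open
  condition on \<open>q\<close> and a superlevel set of \<open>g\<close>; the union over
  \<open>t\<close> is open. This makes the prox objective lower semicontinuous.\<close>

lemma open_superlevel_scale_add:
  fixes g :: "'a::topological_space \<Rightarrow> ereal"
  assumes g: "lower_semicont g" and q: "continuous_on UNIV q" and "\<alpha> > 0"
  shows "open {y. c < ereal \<alpha> * g y + ereal (q y)}"
proof (cases c)
  case (real r)
  have "r < \<alpha> * s + q y \<longleftrightarrow> (r - q y) / \<alpha> < s" for s y
    using \<open>\<alpha> > 0\<close> by (auto simp: field_simps)
  then have iff: "c < ereal \<alpha> * g y + ereal (q y) \<longleftrightarrow> ereal ((r - q y) / \<alpha>) < g y" for y
    using real \<open>\<alpha> > 0\<close> by (cases "g y") auto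
  have "{y. c < ereal \<alpha> * g y + ereal (q y)} = (\<Union>t. {y. (r - q y) / \<alpha> < t} \<inter> {y. ereal t < g y})"
  proof (intro set_eqI iffI)
    fix y assume "y \<in> {y. c < ereal \<alpha> * g y + ereal (q y)}"
    then obtain t where "ereal ((r - q y) / \<alpha>) < ereal t" "ereal t < g y"
      using ereal_dense2 iff by blast
    then show "y \<in> (\<Union>t. {y. (r - q y) / \<alpha> < t} \<inter> {y. ereal t < g y})" by auto
  next
    fix y assume "y \<in> (\<Union>t. {y. (r - q y) / \<alpha> < t} \<inter> {y. ereal t < g y})"
    then obtain t where t: "(r - q y) / \<alpha> < t" "ereal t < g y" by auto
    then have "ereal ((r - q y) / \<alpha>) < g y" by (auto intro: less_trans[of _ "ereal t"])
    then show "y \<in> {y. c < ereal \<alpha> * g y + ereal (q y)}" using iff by simp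
  qed
  moreover have "open {y. (r - q y) / \<alpha> < t}" for t
    using \<open>\<alpha> > 0\<close> by (intro open_Collect_less continuous_intros q) auto
  ultimately show ?thesis
    using open_superlevel_lower_semicont[OF g] by (simp add: open_UN open_Int)
next
  case MInf
  let ?S = "{y. -\<infinity> < g y}"
  have "{y. c < ereal \<alpha> * g y + ereal (q y)} = ?S"
  proof (intro set_eqI)
    fix y
    show "y \<in> {y. c < ereal \<alpha> * g y + ereal (q y)} \<longleftrightarrow> y \<in> ?S"
      using MInf \<open>\<alpha> > 0\<close> by (cases "g y") auto
  qed
  then show ?thesis using open_superlevel_lower_semicont[OF g] by metis
qed auto

text \<open>Without a minimum on \<open>K\<close>, the sets \<open>{y. \<phi> c < \<phi> y}\<close>
  with \<open>c\<close> in \<open>K\<close> cover \<open>K\<close>. In a finite subcover the centre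
  of least value would itself lie in one of these sets, so another centre would have a smaller
  value. Any linear order serves, extended reals included.\<close>

lemma compact_attains_inf_superlevel:
  fixes \<phi> :: "'a::topological_space \<Rightarrow> 'b::linorder"
  assumes "compact K" "K \<noteq> {}" and op: "\<And>c. open {y. c < \<phi> y}"
  shows "\<exists>p\<in>K. \<forall>y\<in>K. \<phi> p \<le> \<phi> y"
proof (rule ccontr)
  assume "\<not> ?thesis"
  then have "K \<subseteq> (\<Union>c\<in>K. {y. \<phi> c < \<phi> y})" by (force simp: not_le)
  then obtain C where C: "C \<subseteq> K" "finite C" "K \<subseteq> (\<Union>c\<in>C. {y. \<phi> c < \<phi> y})"
    using compactE_image[OF \<open>compact K\<close>, of K "\<lambda>c. {y. \<phi> c < \<phi> y}"] op by blast
  then have "C \<noteq> {}" using \<open>K \<noteq> {}\<close> by auto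
  then have "Min (\<phi> ` C) \<in> \<phi> ` C" using C by (intro Min_in) auto
  then obtain m where m: "m \<in> C" "\<phi> m = Min (\<phi> ` C)" by auto
  then obtain c where "c \<in> C" "\<phi> c < \<phi> m" using C by blast
  then show False using m C(2) by (metis Min_le finite_imageI imageI not_less)
qed

section \<open>Extended-real convex functions and the proximal map\<close>

locale proper_convex_lsc =
  fixes g :: "'a::euclidean_space \<Rightarrow> ereal"
  assumes not_MInf: "g y \<noteq> -\<infinity>"
    and convex: "convex_ereal g"
    and lsc: "lower_semicont g"
    and proper: "\<exists>y. g y \<noteq> \<infinity>"
begin

text \<open>\<open>real_of_ereal\<close> sends \<infinity> to 0, so inequalities between values of
  \<open>G\<close> are meaningful only together with finiteness of \<open>g\<close> at the points
  concerned.\<close>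

abbreviation G :: "'a \<Rightarrow> real" where "G y \<equiv> real_of_ereal (g y)"

lemma g_eq: "g y \<noteq> \<infinity> \<Longrightarrow> g y = ereal (G y)"
  using not_MInf[of y] by (cases "g y") auto

lemma G_le_iff: "g y \<noteq> \<infinity> \<Longrightarrow> g z \<noteq> \<infinity> \<Longrightarrow> G y \<le> G z \<longleftrightarrow> g y \<le> g z"
  using not_MInf[of y] not_MInf[of z] by (cases "g y"; cases "g z") auto

lemma finite_convex:
  assumes "g u \<noteq> \<infinity>" "g v \<noteq> \<infinity>" "0 \<le> t" "t \<le> 1"
  shows "g (u + t *\<^sub>R (v - u)) \<noteq> \<infinity>"
    and "G (u + t *\<^sub>R (v - u)) \<le> (1 - t) * G u + t * G v"
proof -
  have eq: "u + t *\<^sub>R (v - u) = (1 - t) *\<^sub>R u + t *\<^sub>R v" by (simp add: algebra_simps)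
  have "g (u + t *\<^sub>R (v - u)) \<le> ereal (1 - t) * g u + ereal t * g v"
    unfolding eq using convex assms(3,4) unfolding convex_ereal_def by blast
  also have "\<dots> = ereal ((1 - t) * G u + t * G v)"
    using assms(1,2) not_MInf[of u] not_MInf[of v] by (cases "g u"; cases "g v") auto
  finally have le: "g (u + t *\<^sub>R (v - u)) \<le> ereal ((1 - t) * G u + t * G v)" .
  then show fin: "g (u + t *\<^sub>R (v - u)) \<noteq> \<infinity>" by auto
  show "G (u + t *\<^sub>R (v - u)) \<le> (1 - t) * G u + t * G v"
    using le by (subst (asm) g_eq[OF fin]) simp
qed

text \<open>A lower bound for \<open>g\<close> on the unit ball around a point of finiteness extends, by convexity along
  rays, to a bound decreasing at most linearly in the distance.\<close>

lemma linear_minorant: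
  assumes "g c \<noteq> \<infinity>"
  obtains a b where "\<And>y. g y \<noteq> \<infinity> \<Longrightarrow> a - b * norm (y - c) \<le> G y" "b \<ge> 0"
proof -
  obtain p where p: "p \<in> cball c 1" "\<And>y. y \<in> cball c 1 \<Longrightarrow> g p \<le> g y"
    using compact_attains_inf_superlevel[of "cball c 1" g] open_superlevel_lower_semicont[OF lsc]
    by auto
  have "g p \<le> g c" using p by auto
  then have "g p \<noteq> \<infinity>" using assms by auto
  then have "G p \<le> G c"
    using \<open>g p \<le> g c\<close> assms by (simp add: G_le_iff)
  show ?thesis
  proof
    show "G c - G p \<ge> 0" using \<open>G p \<le> G c\<close> by simp
    fix y assume y: "g y \<noteq> \<infinity>"
    show "G p - (G c - G p) * norm (y - c) \<le> G y"
    proof (cases "norm (y - c) \<le> 1")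
      case True
      then have "g p \<le> g y" using p by (auto simp: dist_norm norm_minus_commute)
      then have "G p \<le> G y"
        using y \<open>g p \<noteq> \<infinity>\<close> by (simp add: G_le_iff)
      then show ?thesis using \<open>G p \<le> G c\<close>
        by (smt (verit) mult_nonneg_nonneg norm_ge_zero)
    next
      case False
      define r where "r = norm (y - c)"
      have r: "r > 1" using False r_def by simp
      define z where "z = c + (1 / r) *\<^sub>R (y - c)"
      have "norm (z - c) = 1" using r unfolding z_def by (simp add: r_def[symmetric])
      then have "g p \<le> g z" using p by (auto simp: dist_norm norm_minus_commute)
      moreover have z: "g z \<noteq> \<infinity>" "G z \<le> (1 - 1 / r) * G c + (1 / r) * G y"
        unfolding z_def using finite_convex[OF assms y, of "1 / r"] r by auto
      moreover from calculation have "G p \<le> G z" using \<open>g p \<noteq> \<infinity>\<close> by (simp add: G_le_iff)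
      ultimately have "G p \<le> (1 - 1 / r) * G c + (1 / r) * G y" by linarith
      then have "r * G p \<le> r * ((1 - 1 / r) * G c + (1 / r) * G y)"
        using r by (intro mult_left_mono) auto
      also have "\<dots> = (r - 1) * G c + G y" using r by (simp add: field_simps)
      finally have "r * G p - (r - 1) * G c \<le> G y" by simp
      moreover have "G p - (G c - G p) * r \<le> r * G p - (r - 1) * G c"
        using \<open>G p \<le> G c\<close> by (simp add: algebra_simps)
      ultimately show ?thesis by (simp add: r_def)
    qed
  qed
qed

text \<open>\<open>arg_min\<close> is a mere choice, so a minimiser has to be exhibited. Since
  \<open>g\<close> falls at most linearly, the quadratic term wins outside a large ball; inside it,
  compactness yields the minimiser.\<close>

lemma prox_minimal:
  assumes "\<alpha> > 0"
  shows "is_arg_min (\<lambda>y. ereal \<alpha> * g y + ereal ((norm (z - y))\<^sup>2 / 2)) (\<lambda>_. True) (prox g \<alpha> z)"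
proof -
  let ?\<phi> = "\<lambda>y. ereal \<alpha> * g y + ereal ((norm (z - y))\<^sup>2 / 2)"
  obtain c where c: "g c \<noteq> \<infinity>" using proper by blast
  obtain a b where ab: "\<And>y. g y \<noteq> \<infinity> \<Longrightarrow> a - b * norm (y - c) \<le> G y" "b \<ge> 0"
    using linear_minorant[OF c] by blast
  have \<phi>_real: "?\<phi> y = ereal (\<alpha> * G y + (norm (z - y))\<^sup>2 / 2)" if "g y \<noteq> \<infinity>" for y
    by (subst g_eq[OF that]) simp
  \<comment> \<open>With \<open>r\<close> the distance of \<open>y\<close> from \<open>z\<close>,
    \<open>m\<close> collects the terms free of \<open>r\<close> in the comparison with
    \<open>c\<close>, leaving \<open>m \<le> r * (r / 2 - \<alpha> * b)\<close>. Beyond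
    \<open>R\<close> both \<open>r > 1\<close> and
    \<open>r / 2 - \<alpha> * b > \<bar>m\<bar>\<close> hold; the maximum keeps \<open>c\<close>
    inside the ball.\<close>
  define m where "m = \<alpha> * G c + (norm (z - c))\<^sup>2 / 2 - \<alpha> * a + \<alpha> * b * norm (z - c)"
  define R where "R = max (norm (z - c)) (2 * (\<alpha> * b + \<bar>m\<bar> + 1))"
  have far: "?\<phi> c \<le> ?\<phi> y" if y: "norm (z - y) > R" for y
  proof (cases "g y = \<infinity>")
    case False
    define r where "r = norm (z - y)"
    have r: "r > 2 * (\<alpha> * b + \<bar>m\<bar> + 1)" using y by (simp add: r_def R_def)
    have \<alpha>b: "\<alpha> * b \<ge> 0" using assms ab by simp
    have "norm (y - c) \<le> r + norm (z - c)"
      unfolding r_def using norm_triangle_ineq4[of "z - c" "z - y"] by simp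
    then have "\<alpha> * b * norm (y - c) \<le> \<alpha> * b * (r + norm (z - c))"
      using \<alpha>b by (rule mult_left_mono)
    moreover have "\<alpha> * (a - b * norm (y - c)) \<le> \<alpha> * G y"
      using ab(1)[OF False] assms by (intro mult_left_mono) auto
    ultimately have "\<alpha> * a - \<alpha> * b * (r + norm (z - c)) \<le> \<alpha> * G y"
      by (simp add: algebra_simps)
    moreover have "m \<le> r * (r / 2 - \<alpha> * b)"
    proof -
      have "\<bar>m\<bar> * 1 \<le> (r / 2 - \<alpha> * b) * r"
        using r \<alpha>b by (intro mult_mono) (auto simp: field_simps)
      then show ?thesis by (simp add: mult.commute)
    qed
    ultimately have "\<alpha> * G c + (norm (z - c))\<^sup>2 / 2 \<le> \<alpha> * G y + r\<^sup>2 / 2"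
      by (simp add: m_def algebra_simps power2_eq_square)
    then show ?thesis using \<phi>_real[OF False] \<phi>_real[OF c] by (simp add: r_def)
  qed (use assms in simp)
  have op: "open {y. t < ?\<phi> y}" for t
    by (rule open_superlevel_scale_add[OF lsc _ assms]) (intro continuous_intros, simp)
  have "c \<in> cball z R" by (simp add: R_def dist_norm)
  then have "cball z R \<noteq> {}" by blast
  then have "\<exists>p\<in>cball z R. \<forall>y\<in>cball z R. ?\<phi> p \<le> ?\<phi> y"
    using op by (intro compact_attains_inf_superlevel compact_cball)
  then obtain p where p: "p \<in> cball z R" "\<And>y. y \<in> cball z R \<Longrightarrow> ?\<phi> p \<le> ?\<phi> y"
    by blast
  have "?\<phi> p \<le> ?\<phi> y" for y
  proof (cases "norm (z - y) > R")
    case True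
    have "?\<phi> p \<le> ?\<phi> c" using \<open>c \<in> cball z R\<close> by (rule p(2))
    with far[OF True] show ?thesis by (rule order_trans[rotated])
  next
    case False
    then show ?thesis by (intro p(2)) (simp add: dist_norm)
  qed
  then have "is_arg_min ?\<phi> (\<lambda>_. True) p"
    by (auto simp: is_arg_min_def not_less)
  then show ?thesis unfolding prox_def arg_min_def by (rule someI)
qed

lemma prox_finite:
  assumes "\<alpha> > 0"
  shows "g (prox g \<alpha> z) \<noteq> \<infinity>"
proof
  assume inf: "g (prox g \<alpha> z) = \<infinity>"
  obtain c where c: "g c \<noteq> \<infinity>" using proper by blast
  have "\<not> ereal \<alpha> * g c + ereal ((norm (z - c))\<^sup>2 / 2)
      < ereal \<alpha> * g (prox g \<alpha> z) + ereal ((norm (z - prox g \<alpha> z))\<^sup>2 / 2)"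
    using prox_minimal[OF assms, of z] unfolding is_arg_min_def by blast
  then show False using assms inf g_eq[OF c] by (cases "g c") auto
qed

text \<open>First-order optimality: \<open>(z - p) / \<alpha>\<close> is a subgradient of
  \<open>g\<close> at the prox point \<open>p\<close>. It follows from comparing \<open>p\<close>
  with nearby points of the segment towards \<open>y\<close>.\<close>

lemma prox_subgradient:
  assumes "\<alpha> > 0" and y: "g y \<noteq> \<infinity>"
  shows "\<alpha> * G (prox g \<alpha> z) + (z - prox g \<alpha> z) \<bullet> (y - prox g \<alpha> z) \<le> \<alpha> * G y"
proof -
  define p where "p = prox g \<alpha> z"
  have p: "g p \<noteq> \<infinity>" unfolding p_def by (rule prox_finite) fact
  \<comment> \<open>Convexity bounds \<open>g\<close> on the segment; after division by
    \<open>t\<close> the quadratic term leaves a remainder of order \<open>t\<close>, which the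
    right limit at 0 removes.\<close>
  have *: "\<alpha> * G p + (z - p) \<bullet> (y - p) \<le> \<alpha> * G y + t * ((norm (y - p))\<^sup>2 / 2)"
    if t: "0 < t" "t \<le> 1" for t
  proof -
    let ?w = "p + t *\<^sub>R (y - p)"
    have w: "g ?w \<noteq> \<infinity>" "G ?w \<le> (1 - t) * G p + t * G y"
      using finite_convex[OF p y, of t] t by auto
    have "\<not> ereal \<alpha> * g ?w + ereal ((norm (z - ?w))\<^sup>2 / 2)
        < ereal \<alpha> * g p + ereal ((norm (z - p))\<^sup>2 / 2)"
      using prox_minimal[OF assms(1), of z] unfolding is_arg_min_def p_def by blast
    then have "\<alpha> * G p + (norm (z - p))\<^sup>2 / 2 \<le> \<alpha> * G ?w + (norm (z - ?w))\<^sup>2 / 2"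
      by (subst (asm) g_eq[OF p], subst (asm) g_eq[OF w(1)]) simp
    also have "\<alpha> * G ?w \<le> \<alpha> * ((1 - t) * G p + t * G y)"
      using w(2) assms by (intro mult_left_mono) auto
    also have "(norm (z - ?w))\<^sup>2 = (norm (z - p))\<^sup>2 - 2 * t * ((z - p) \<bullet> (y - p)) + t\<^sup>2 * (norm (y - p))\<^sup>2"
    proof -
      have "(norm (a - t *\<^sub>R b))\<^sup>2 = (norm a)\<^sup>2 - 2 * t * (a \<bullet> b) + t\<^sup>2 * (norm b)\<^sup>2" for a b :: 'a
        unfolding power2_norm_eq_inner by (simp add: inner_simps inner_commute power2_eq_square)
      from this[of "z - p" "y - p"] show ?thesis by (simp add: algebra_simps)
    qed
    finally have "\<alpha> * G p + (norm (z - p))\<^sup>2 / 2 \<le> \<alpha> * ((1 - t) * G p + t * G y)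
        + ((norm (z - p))\<^sup>2 - 2 * t * ((z - p) \<bullet> (y - p)) + t\<^sup>2 * (norm (y - p))\<^sup>2) / 2" by simp
    then have "t * (\<alpha> * G p + d) \<le> t * (\<alpha> * G y + t * ((norm (y - p))\<^sup>2 / 2))"
      if "d = (z - p) \<bullet> (y - p)" for d
      unfolding that[symmetric] by (simp add: field_simps power2_eq_square)
    then show ?thesis using t by (simp only: mult_le_cancel_left_pos)
  qed
  have "\<alpha> * G p + (z - p) \<bullet> (y - p) \<le> \<alpha> * G y"
  proof (rule tendsto_lowerbound)
    show "((\<lambda>t. \<alpha> * G y + t * ((norm (y - p))\<^sup>2 / 2)) \<longlongrightarrow> \<alpha> * G y) (at_right 0)"
      by (auto intro!: tendsto_eq_intros)
    show "\<forall>\<^sub>F t in at_right 0. \<alpha> * G p + (z - p) \<bullet> (y - p) \<le> \<alpha> * G y + t * ((norm (y - p))\<^sup>2 / 2)"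
      unfolding eventually_at_right_field using * by (intro exI[of _ 1]) auto
  qed simp
  then show ?thesis by (simp add: p_def)
qed

text \<open>The subgradient inequalities at the two prox points, each tested at the other point, add
  up to \<open>(norm (p - q))\<^sup>2 \<le> (z - w) \<bullet> (p - q)\<close>; Cauchy-Schwarz
  finishes.\<close>

lemma prox_nonexpansive:
  assumes "\<alpha> > 0"
  shows "norm (prox g \<alpha> z - prox g \<alpha> w) \<le> norm (z - w)"
proof -
  define p q where "p = prox g \<alpha> z" and "q = prox g \<alpha> w"
  have "\<alpha> * G p + (z - p) \<bullet> (q - p) \<le> \<alpha> * G q" "\<alpha> * G q + (w - q) \<bullet> (p - q) \<le> \<alpha> * G p"
    unfolding p_def q_def by (intro prox_subgradient prox_finite assms)+
  then have "(norm (p - q))\<^sup>2 \<le> (z - w) \<bullet> (p - q)"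
    by (simp add: power2_norm_eq_inner inner_simps inner_commute algebra_simps)
  also have "\<dots> \<le> norm (z - w) * norm (p - q)" by (rule norm_cauchy_schwarz)
  finally have "norm (p - q) * norm (p - q) \<le> norm (z - w) * norm (p - q)"
    by (simp add: power2_eq_square)
  then show ?thesis unfolding p_def q_def
    by (cases "p = q") (auto simp: p_def q_def)
qed

end

section \<open>Smoothness and distance estimates\<close>

text \<open>Along the segment, \<open>f\<close> minus the linear and quadratic terms of the bound is
  nonincreasing, because the Lipschitz gradient makes its derivative nonpositive.\<close>

lemma descent_lemma:
  fixes f :: "'a::real_inner \<Rightarrow> real"
  assumes grad: "\<And>y. GDERIV f y :> f' y"
    and Lip: "\<And>y z. norm (f' z - f' y) \<le> L * norm (z - y)"
  shows "f y \<le> f x + f' x \<bullet> (y - x) + L / 2 * (norm (y - x))\<^sup>2"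
proof -
  define d where "d = y - x"
  define \<phi> where "\<phi> t = f (x + t *\<^sub>R d) - t * (f' x \<bullet> d) - L / 2 * t\<^sup>2 * (norm d)\<^sup>2" for t
  have deriv: "(\<phi> has_real_derivative (d \<bullet> f' (x + t *\<^sub>R d) - f' x \<bullet> d - L * t * (norm d)\<^sup>2)) (at t)" for t
  proof -
    have line: "((\<lambda>t. x + t *\<^sub>R d) has_derivative (\<lambda>h. h *\<^sub>R d)) (at t)"
      by (auto intro!: derivative_eq_intros)
    have "((\<lambda>t. f (x + t *\<^sub>R d)) has_derivative (\<lambda>h. (h *\<^sub>R d) \<bullet> f' (x + t *\<^sub>R d))) (at t)"
      by (rule has_derivative_compose[OF line grad[unfolded gderiv_def]])
    then have "((\<lambda>t. f (x + t *\<^sub>R d)) has_real_derivative (d \<bullet> f' (x + t *\<^sub>R d))) (at t)"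
      by (rule has_derivative_imp_has_field_derivative) (simp add: mult.commute)
    then show ?thesis unfolding \<phi>_def by (auto intro!: derivative_eq_intros)
  qed
  have nonpos: "d \<bullet> f' (x + t *\<^sub>R d) - f' x \<bullet> d - L * t * (norm d)\<^sup>2 \<le> 0" if "0 \<le> t" for t
  proof -
    have "d \<bullet> f' (x + t *\<^sub>R d) - f' x \<bullet> d = d \<bullet> (f' (x + t *\<^sub>R d) - f' x)"
      by (simp add: inner_simps inner_commute)
    also have "\<dots> \<le> norm d * norm (f' (x + t *\<^sub>R d) - f' x)" by (rule norm_cauchy_schwarz)
    also have "\<dots> \<le> norm d * (L * norm (t *\<^sub>R d))"
      using Lip[where z="x + t *\<^sub>R d" and y=x] by (intro mult_left_mono) auto
    finally show ?thesis using that by (simp add: power2_eq_square algebra_simps)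
  qed
  have "\<phi> 1 \<le> \<phi> 0"
  proof (rule DERIV_nonpos_imp_nonincreasing[where f=\<phi>])
    fix t :: real assume "0 \<le> t"
    then show "\<exists>D. (\<phi> has_real_derivative D) (at t) \<and> D \<le> 0"
      using deriv[of t] nonpos[of t] by blast
  qed simp
  then show ?thesis by (simp add: \<phi>_def d_def)
qed

text \<open>Passes an estimate valid at every minimiser to the distance from the solution set
  without producing a nearest point.\<close>

lemma infdist_square_greatest:
  assumes "A \<noteq> {}" and "\<And>a. a \<in> A \<Longrightarrow> c \<le> (dist x a)\<^sup>2"
  shows "c \<le> (infdist x A)\<^sup>2"
proof (cases "c \<le> 0")
  case False
  have "sqrt c \<le> infdist x A"
    unfolding infdist_notempty[OF assms(1)]
    by (rule cINF_greatest) (use assms in \<open>auto intro: real_le_lsqrt\<close>)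
  then have "(sqrt c)\<^sup>2 \<le> (infdist x A)\<^sup>2" using False by (intro power_mono) auto
  then show ?thesis using False by simp
qed (auto intro: order_trans)

section \<open>One inexact proximal gradient step and its iteration\<close>

locale prox_gradient = proper_convex_lsc g
  for g :: "'a::euclidean_space \<Rightarrow> ereal" +
  fixes f :: "'a \<Rightarrow> real" and f' :: "'a \<Rightarrow> 'a" and L \<tau> :: real
  assumes grad: "GDERIV f y :> f' y"
    and L_pos: "L > 0"
    and Lipschitz: "norm (f' z - f' y) \<le> L * norm (z - y)"
    and tau_ge_1: "\<tau> \<ge> 1"
    and argmin_nonempty: "argmin_set (objective f g) \<noteq> {}"
    and error_bound: "infdist y (argmin_set (objective f g))
      \<le> \<tau> * norm (y - prox g (1 / L) (y - (1 / L) *\<^sub>R f' y))"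
begin

abbreviation H :: "'a \<Rightarrow> real" where "H y \<equiv> f y + G y"

lemma argmin_finite:
  assumes "s \<in> argmin_set (objective f g)"
  shows "g s \<noteq> \<infinity>"
proof
  assume "g s = \<infinity>"
  obtain c where c: "g c \<noteq> \<infinity>" using proper by blast
  then have "objective f g c < objective f g s"
    using \<open>g s = \<infinity>\<close> not_MInf[of c] unfolding objective_def by (cases "g c") auto
  then show False using assms unfolding argmin_set_def is_arg_min_def by auto
qed

lemma argmin_le:
  assumes "s \<in> argmin_set (objective f g)" "g y \<noteq> \<infinity>"
  shows "H s \<le> H y"
proof -
  have "\<not> objective f g y < objective f g s"
    using assms(1) unfolding argmin_set_def is_arg_min_def by auto
  then show ?thesis
    using not_MInf[of y] not_MInf[of s] assms(2) argmin_finite[OF assms(1)]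
    unfolding objective_def by (cases "g y"; cases "g s") auto
qed

text \<open>At finite points the gap becomes a difference of reals, so the contraction argument can
  use real arithmetic.\<close>

lemma opt_gap_eq:
  assumes "s \<in> argmin_set (objective f g)" "g y \<noteq> \<infinity>"
  shows "opt_gap (objective f g) y = ereal (H y - H s)"
proof -
  have "(INF z. objective f g z) = objective f g s"
  proof (rule antisym)
    show "objective f g s \<le> (INF z. objective f g z)"
      using assms(1) unfolding argmin_set_def is_arg_min_def
      by (intro INF_greatest) (auto simp: not_less)
  qed (rule INF_lower, simp)
  then show ?thesis
    using not_MInf[of y] not_MInf[of s] assms(2) argmin_finite[OF assms(1)]
    unfolding opt_gap_def objective_def by (cases "g y"; cases "g s") auto
qed

lemma prox_gradient_step:
  fixes x e s :: 'a
  assumes x: "g x \<noteq> \<infinity>" and s: "s \<in> argmin_set (objective f g)"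
  defines "xp \<equiv> prox g (1 / L) (x - (1 / L) *\<^sub>R (f' x + e))"
  shows "H xp - H s \<le> rate \<tau> * (H x - H s) + 2 / L * (norm e)\<^sup>2"
proof -
  define d where "d = xp - x"
  define v where "v = f' x"
  define E where "E = (norm e)\<^sup>2 / L"
  have descent: "f y \<le> f w + f' w \<bullet> (y - w) + L / 2 * (norm (y - w))\<^sup>2" for y w
    by (rule descent_lemma) (fact grad Lipschitz)+
  have xp: "g xp \<noteq> \<infinity>" unfolding xp_def using L_pos by (intro prox_finite) simp
  have prox: "G xp + (L *\<^sub>R (x - xp) - (v + e)) \<bullet> (y - xp) \<le> G y" if "g y \<noteq> \<infinity>" for y
  proof -
    have "1 / L * G xp + (x - (1 / L) *\<^sub>R (v + e) - xp) \<bullet> (y - xp) \<le> 1 / L * G y"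
      unfolding xp_def v_def using prox_subgradient[of "1 / L" y] L_pos that by simp
    then have "L * (1 / L * G xp + (x - (1 / L) *\<^sub>R (v + e) - xp) \<bullet> (y - xp)) \<le> L * (1 / L * G y)"
      using L_pos by (intro mult_left_mono) auto
    moreover have "L * ((x - (1 / L) *\<^sub>R (v + e) - xp) \<bullet> (y - xp))
        = (L *\<^sub>R (x - (1 / L) *\<^sub>R (v + e) - xp)) \<bullet> (y - xp)" by simp
    moreover have "L *\<^sub>R (x - (1 / L) *\<^sub>R (v + e) - xp) = L *\<^sub>R (x - xp) - (v + e)"
      using L_pos by (simp add: algebra_simps)
    ultimately show ?thesis using L_pos by (simp add: distrib_left)
  qed
  have f_xp: "f xp \<le> f x + v \<bullet> d + L / 2 * (norm d)\<^sup>2"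
    using descent[of xp x] by (simp add: d_def v_def)
  have decrease: "L / 4 * (norm d)\<^sup>2 \<le> H x - H xp + E"
  proof -
    have "G xp + L * (norm d)\<^sup>2 + (v + e) \<bullet> d \<le> G x"
      using prox[OF x] unfolding power2_norm_eq_inner d_def
      by (simp add: inner_simps inner_commute algebra_simps)
    \<comment> \<open>Completing the square: half of the available decrease
      \<open>L / 2 * (norm d)\<^sup>2\<close> absorbs the cross term \<open>e \<bullet> d\<close>,
      at the cost of \<open>E\<close>.\<close>
    moreover have "0 \<le> (norm ((L / 2) *\<^sub>R d + e))\<^sup>2 / L" using L_pos by simp
    moreover have "(norm ((L / 2) *\<^sub>R d + e))\<^sup>2 / L = L / 4 * (norm d)\<^sup>2 + e \<bullet> d + E"
      using L_pos unfolding E_def power2_norm_eq_inner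
      by (simp add: inner_simps inner_commute field_simps)
    ultimately show ?thesis using f_xp by (simp add: inner_simps)
  qed
  have gap_le_dist: "H xp - H s \<le> L * (dist x a)\<^sup>2 + E / 2"
    if a: "a \<in> argmin_set (objective f g)" for a
  proof -
    define u where "u = a - x"
    have "f x + v \<bullet> u \<le> f a + L / 2 * (norm u)\<^sup>2"
    proof -
      \<comment> \<open>\<open>f\<close> may be nonconvex, so the lower bound on \<open>f a\<close>
        comes from the descent lemma for \<open>- f\<close>, whose gradient has the same Lipschitz
        constant.\<close>
      have "GDERIV (\<lambda>y. - f y) y :> - f' y" for y
        using grad[of y] by (rule GDERIV_minus)
      moreover have "norm (- f' z - - f' y) \<le> L * norm (z - y)" for y z
        using Lipschitz[of y z] by (simp add: norm_minus_commute)
      ultimately have "- f a \<le> - f x + (- f' x) \<bullet> (a - x) + L / 2 * (norm (a - x))\<^sup>2"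
        by (rule descent_lemma)
      then show ?thesis by (simp add: u_def v_def)
    qed
    moreover have "G xp + (- (L *\<^sub>R d) - (v + e)) \<bullet> (u - d) \<le> G a"
      using prox[OF argmin_finite[OF a]] by (simp add: d_def u_def algebra_simps)
    \<comment> \<open>Polarization produces the strong convexity term in \<open>u - d\<close>; the
      square below spends it on \<open>e \<bullet> (u - d)\<close> and leaves only
      \<open>E / 2\<close>.\<close>
    moreover have "(- (L *\<^sub>R d) - (v + e)) \<bullet> (u - d)
        = L / 2 * (norm (u - d))\<^sup>2 + L / 2 * (norm d)\<^sup>2 - L / 2 * (norm u)\<^sup>2
          - v \<bullet> u + v \<bullet> d - e \<bullet> (u - d)"
      unfolding power2_norm_eq_inner by (simp add: inner_simps inner_commute algebra_simps)
    moreover have "0 \<le> (norm (L *\<^sub>R (u - d) - e))\<^sup>2 / (2 * L)" using L_pos by simp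
    moreover have "(norm (L *\<^sub>R (u - d) - e))\<^sup>2 / (2 * L)
        = L / 2 * (norm (u - d))\<^sup>2 - e \<bullet> (u - d) + E / 2"
    proof -
      have "(norm (L *\<^sub>R b - e))\<^sup>2 / (2 * L) = L / 2 * (norm b)\<^sup>2 - e \<bullet> b + E / 2" for b
        using L_pos unfolding E_def power2_norm_eq_inner
        by (simp add: inner_simps inner_commute field_simps)
      then show ?thesis .
    qed
    moreover have "H a = H s" using argmin_le a s argmin_finite by (metis order_antisym)
    moreover have "(norm u)\<^sup>2 = (dist x a)\<^sup>2" by (simp add: u_def dist_norm norm_minus_commute)
    ultimately show ?thesis using f_xp by simp
  qed
  define D where "D = infdist x (argmin_set (objective f g))"
  have "(H xp - H s - E / 2) / L \<le> D\<^sup>2" unfolding D_def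
    using gap_le_dist L_pos by (intro infdist_square_greatest argmin_nonempty) (simp add: field_simps)
  then have gap_le: "H xp - H s \<le> L * D\<^sup>2 + E / 2" using L_pos by (simp add: field_simps)
  \<comment> \<open>The error bound refers to the exact step \<open>?y\<close>, while
    \<open>xp\<close> is perturbed by \<open>e / L\<close> before the prox; nonexpansiveness limits
    the difference to \<open>norm e / L\<close>.\<close>
  have "D \<le> \<tau> * (norm d + norm e / L)"
  proof -
    let ?y = "prox g (1 / L) (x - (1 / L) *\<^sub>R f' x)"
    have "norm (xp - ?y) \<le> norm ((x - (1 / L) *\<^sub>R (f' x + e)) - (x - (1 / L) *\<^sub>R f' x))"
      unfolding xp_def using L_pos by (intro prox_nonexpansive) simp
    also have "\<dots> = norm e / L" using L_pos by (simp add: algebra_simps)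
    finally have "norm (x - ?y) \<le> norm d + norm e / L"
      using norm_triangle_ineq4[of "xp - ?y" d] by (simp add: d_def)
    then have "\<tau> * norm (x - ?y) \<le> \<tau> * (norm d + norm e / L)"
      using tau_ge_1 by (intro mult_left_mono) auto
    then show ?thesis unfolding D_def using error_bound[of x] by simp
  qed
  then have "D\<^sup>2 \<le> (\<tau> * (norm d + norm e / L))\<^sup>2"
    unfolding D_def by (intro power_mono infdist_nonneg)
  also have "\<dots> = \<tau>\<^sup>2 * (norm d + norm e / L)\<^sup>2" by (simp add: power_mult_distrib)
  also have "\<dots> \<le> \<tau>\<^sup>2 * (2 * (norm d)\<^sup>2 + 2 * (norm e / L)\<^sup>2)"
    using zero_le_power2[of "norm d - norm e / L"]
    by (intro mult_left_mono) (auto simp: power2_diff power2_sum)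
  finally have "L * D\<^sup>2 \<le> L * (\<tau>\<^sup>2 * (2 * (norm d)\<^sup>2 + 2 * (norm e / L)\<^sup>2))"
    using L_pos by (intro mult_left_mono) auto
  \<comment> \<open>The squared step is grouped as \<open>L / 4 * (norm d)\<^sup>2\<close> so that
    \<open>decrease\<close> applies. The resulting factor 8, multiplied by 5 below, is the 40 in
    \<open>rate\<close>.\<close>
  also have "\<dots> = 8 * \<tau>\<^sup>2 * (L / 4 * (norm d)\<^sup>2) + 2 * \<tau>\<^sup>2 * E"
    using L_pos by (simp add: E_def field_simps power2_eq_square)
  also have "\<dots> \<le> 8 * \<tau>\<^sup>2 * (H x - H xp + E) + 2 * \<tau>\<^sup>2 * E"
    using decrease by (intro add_right_mono mult_left_mono) auto
  finally have key: "H xp - H s \<le> 8 * \<tau>\<^sup>2 * (H x - H xp + E) + 2 * \<tau>\<^sup>2 * E + E / 2"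
    using gap_le by linarith
  define T where "T = \<tau>\<^sup>2"
  define p where "p = H xp - H s"
  define q where "q = H x - H s"
  have "T \<ge> 1" "E \<ge> 0" "p \<ge> 0"
    using tau_ge_1 L_pos argmin_le[OF s xp] by (auto simp: T_def E_def p_def)
  have "H x - H xp = q - p" by (simp add: p_def q_def)
  then have "p \<le> 8 * T * (q - p + E) + 2 * T * E + E / 2"
    using key by (simp only: T_def p_def[symmetric])
  moreover have "E \<le> T * E" using \<open>T \<ge> 1\<close> \<open>E \<ge> 0\<close> by (simp add: mult_le_cancel_right1)
  \<comment> \<open>Five times the first inequality; \<open>T \<ge> 1\<close> and \<open>p \<ge> 0\<close> absorb the excess constants.\<close>
  ultimately have "(1 + 40 * T) * p \<le> 40 * T * q + (1 + 40 * T) * (2 * E)"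
    using \<open>p \<ge> 0\<close> \<open>E \<ge> 0\<close> by (simp add: algebra_simps)
  then have "p \<le> (40 * T * q + (1 + 40 * T) * (2 * E)) / (1 + 40 * T)"
    using \<open>T \<ge> 1\<close> by (simp add: pos_le_divide_eq mult.commute)
  also have "\<dots> = 40 * T / (1 + 40 * T) * q + 2 * E"
    using \<open>T \<ge> 1\<close> by (simp add: add_divide_distrib)
  finally show ?thesis by (simp add: rate_def T_def p_def q_def E_def)
qed

lemma rate_bounds: "0 < rate \<tau>" "rate \<tau> < 1"
  using tau_ge_1 unfolding rate_def by (auto simp: add_pos_nonneg)

text \<open>A pathwise bound without probability: the error made in step \<open>i\<close> passes
  through the \<open>k - Suc i\<close> contractions that follow it.\<close>

lemma prox_gradient_iterates:
  assumes x0: "g (x 0) \<noteq> \<infinity>"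
    and step: "\<And>k. x (Suc k) = prox g (1 / L) (x k - (1 / L) *\<^sub>R (f' (x k) + e k))"
  shows "opt_gap (objective f g) (x k) - ereal (rate \<tau> ^ k) * opt_gap (objective f g) (x 0)
    \<le> ereal (\<Sum>i<k. 2 / L * rate \<tau> ^ (k - Suc i) * (norm (e i))\<^sup>2)"
proof -
  obtain s where s: "s \<in> argmin_set (objective f g)" using argmin_nonempty by blast
  let ?S = "\<lambda>k. \<Sum>i<k. 2 / L * rate \<tau> ^ (k - Suc i) * (norm (e i))\<^sup>2"
  have fin: "g (x k) \<noteq> \<infinity>" for k
    using x0 prox_finite[of "1 / L"] L_pos by (cases k) (simp_all add: step)
  have "H (x k) - H s \<le> rate \<tau> ^ k * (H (x 0) - H s) + ?S k"
  proof (induction k)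
    case (Suc k)
    have "H (x (Suc k)) - H s \<le> rate \<tau> * (H (x k) - H s) + 2 / L * (norm (e k))\<^sup>2"
      unfolding step by (rule prox_gradient_step[OF fin s])
    also have "rate \<tau> * (H (x k) - H s) \<le> rate \<tau> * (rate \<tau> ^ k * (H (x 0) - H s) + ?S k)"
      using Suc.IH rate_bounds by (intro mult_left_mono) auto
    also have "rate \<tau> * ?S k = (\<Sum>i<k. 2 / L * rate \<tau> ^ (Suc k - Suc i) * (norm (e i))\<^sup>2)"
      unfolding sum_distrib_left
      by (rule sum.cong) (auto simp: Suc_diff_Suc[symmetric])
    then have "rate \<tau> * (rate \<tau> ^ k * (H (x 0) - H s) + ?S k) + 2 / L * (norm (e k))\<^sup>2
        = rate \<tau> ^ Suc k * (H (x 0) - H s) + ?S (Suc k)"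
      by (simp add: distrib_left)
    finally show ?case by simp
  qed simp
  then show ?thesis using opt_gap_eq[OF s fin] by simp
qed

end

section \<open>From conditional tails to the tail of the accumulated error\<close>

lemma (in prob_space) subalgebra_past:
  assumes "\<And>k. e k \<in> borel_measurable M"
  shows "subalgebra M (past M e k)"
proof -
  have "{e j -` B \<inter> space M |j B. j < k \<and> B \<in> sets borel} \<subseteq> events"
    using assms by (auto intro: measurable_sets)
  then show ?thesis
    unfolding subalgebra_def past_def space_measure_of_conv sets_measure_of_conv
    by (auto dest: sets.sigma_sets_subset)
qed

text \<open>The conditional probability integrates to the unconditional one, so an almost sure
  constant bound survives integration.\<close>

lemma (in prob_space) prob_le_of_cond_prob_given:
  assumes F: "subalgebra M F" and ev: "{\<omega> \<in> space M. P \<omega>} \<in> events"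
    and AE: "AE \<omega> in M. cond_prob_given M F P \<omega> \<le> c"
  shows "\<P>(\<omega> in M. P \<omega>) \<le> c"
proof -
  interpret F: finite_measure_subalgebra M F
    using F by unfold_locales
  let ?I = "indicat_real {\<omega> \<in> space M. P \<omega>}"
  have I: "integrable M ?I"
    using ev by (intro integrable_real_indicator) (simp_all add: less_top[symmetric])
  have "\<P>(\<omega> in M. P \<omega>) = (\<integral>\<omega>. ?I \<omega> \<partial>M)" using ev by simp
  also have "\<dots> = (\<integral>\<omega>. cond_prob_given M F P \<omega> \<partial>M)"
    unfolding cond_prob_given_def using F.real_cond_exp_int(2)[OF I] by simp
  also have "\<dots> \<le> (\<integral>\<omega>. c \<partial>M)"
    using F.real_cond_exp_int(1)[OF I] AE
    by (intro integral_mono_AE) (auto simp: cond_prob_given_def)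
  finally show ?thesis by (simp add: prob_space)
qed

text \<open>If the squared norm reaches \<open>t\<close>, some component has modulus at least
  \<open>sqrt (t / CARD('n))\<close>. The two signs of each component give the factor 2 in the union
  bound.\<close>

lemma (in prob_space) prob_norm_square_ge:
  fixes X :: "'a \<Rightarrow> real ^ 'n"
  assumes X[measurable]: "X \<in> borel_measurable M" and "t > 0"
    and upper: "\<And>i \<epsilon>. \<epsilon> > 0 \<Longrightarrow> \<P>(\<omega> in M. X \<omega> $ i \<ge> \<epsilon>) \<le> exp (- (\<epsilon>\<^sup>2 / u))"
    and lower: "\<And>i \<epsilon>. \<epsilon> > 0 \<Longrightarrow> \<P>(\<omega> in M. - (X \<omega> $ i) \<ge> \<epsilon>) \<le> exp (- (\<epsilon>\<^sup>2 / u))"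
  shows "\<P>(\<omega> in M. t \<le> (norm (X \<omega>))\<^sup>2) \<le> 2 * real CARD('n) * exp (- (t / (real CARD('n) * u)))"
proof -
  define s where "s = sqrt (t / CARD('n))"
  have s: "s > 0" "s\<^sup>2 = t / CARD('n)" using \<open>t > 0\<close> by (auto simp: s_def)
  let ?A = "\<lambda>i. {\<omega> \<in> space M. X \<omega> $ i \<ge> s}"
  let ?B = "\<lambda>i. {\<omega> \<in> space M. - (X \<omega> $ i) \<ge> s}"
  have meas: "?A i \<in> events" "?B i \<in> events" for i by measurable
  have "{\<omega> \<in> space M. t \<le> (norm (X \<omega>))\<^sup>2} \<subseteq> (\<Union>i\<in>UNIV. ?A i \<union> ?B i)"
  proof
    fix \<omega> assume \<omega>: "\<omega> \<in> {\<omega> \<in> space M. t \<le> (norm (X \<omega>))\<^sup>2}"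
    show "\<omega> \<in> (\<Union>i\<in>UNIV. ?A i \<union> ?B i)"
    proof (rule ccontr)
      assume "\<not> ?thesis"
      then have "\<bar>X \<omega> $ i\<bar> < s" for i using \<omega> by (auto simp: not_le abs_if)
      then have "(X \<omega> $ i)\<^sup>2 < s\<^sup>2" for i
        using s(1) by (metis abs_of_pos power2_abs power2_strict_mono)
      then have "(\<Sum>i\<in>UNIV. (X \<omega> $ i)\<^sup>2) < (\<Sum>i\<in>(UNIV :: 'n set). s\<^sup>2)"
        by (intro sum_strict_mono) auto
      then show False using \<omega> s(2)
        by (auto simp: norm_vec_def L2_set_def sum_nonneg)
    qed
  qed
  then have "\<P>(\<omega> in M. t \<le> (norm (X \<omega>))\<^sup>2) \<le> prob (\<Union>i\<in>UNIV. ?A i \<union> ?B i)"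
    using meas by (intro finite_measure_mono) auto
  also have "\<dots> \<le> (\<Sum>i\<in>UNIV. prob (?A i \<union> ?B i))"
    using meas by (intro finite_measure_subadditive_finite) auto
  also have "\<dots> \<le> (\<Sum>i\<in>(UNIV :: 'n set). exp (- (s\<^sup>2 / u)) + exp (- (s\<^sup>2 / u)))"
  proof (rule sum_mono)
    fix i
    have "prob (?A i \<union> ?B i) \<le> prob (?A i) + prob (?B i)"
      using meas by (intro measure_Un_le)
    then show "prob (?A i \<union> ?B i) \<le> exp (- (s\<^sup>2 / u)) + exp (- (s\<^sup>2 / u))"
      using upper[OF s(1), of i] lower[OF s(1), of i] by linarith
  qed
  also have "\<dots> = 2 * real CARD('n) * exp (- (t / (real CARD('n) * u)))"
    by (simp add: s(2))
  finally show ?thesis .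
qed

text \<open>A sum reaching \<open>\<epsilon>\<close> has a summand of at least
  \<open>\<epsilon> / card I\<close>. The tail of \<open>Z i\<close> at that level divided by
  \<open>w i\<close> has scale \<open>w i * v i\<close>, which \<open>V\<close> dominates
  uniformly.\<close>

lemma (in prob_space) prob_weighted_sum_ge:
  fixes Z :: "'i \<Rightarrow> 'a \<Rightarrow> real" and K V \<epsilon> :: real
  assumes I: "finite I" and Z[measurable]: "\<And>i. i \<in> I \<Longrightarrow> Z i \<in> borel_measurable M"
    and tail: "\<And>i t. i \<in> I \<Longrightarrow> t > 0 \<Longrightarrow> \<P>(\<omega> in M. t \<le> Z i \<omega>) \<le> K * exp (- (t / v i))"
    and w: "\<And>i. i \<in> I \<Longrightarrow> w i > 0" and v: "\<And>i. i \<in> I \<Longrightarrow> v i > 0"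
    and V: "\<And>i. i \<in> I \<Longrightarrow> w i * v i \<le> V" and "K \<ge> 0" "\<epsilon> > 0"
  shows "\<P>(\<omega> in M. \<epsilon> \<le> (\<Sum>i\<in>I. w i * Z i \<omega>)) \<le> real (card I) * K * exp (- (\<epsilon> / (real (card I) * V)))"
proof (cases "I = {}")
  case False
  define N where "N = real (card I)"
  have N: "N > 0" using False I by (simp add: N_def card_gt_0_iff)
  let ?A = "\<lambda>i. {\<omega> \<in> space M. \<epsilon> / (N * w i) \<le> Z i \<omega>}"
  have meas: "?A i \<in> events" if "i \<in> I" for i using Z[OF that] by measurable
  have "{\<omega> \<in> space M. \<epsilon> \<le> (\<Sum>i\<in>I. w i * Z i \<omega>)} \<subseteq> (\<Union>i\<in>I. ?A i)"
  proof
    fix \<omega> assume \<omega>: "\<omega> \<in> {\<omega> \<in> space M. \<epsilon> \<le> (\<Sum>i\<in>I. w i * Z i \<omega>)}"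
    show "\<omega> \<in> (\<Union>i\<in>I. ?A i)"
    proof (rule ccontr)
      assume "\<not> ?thesis"
      then have "w i * Z i \<omega> < \<epsilon> / N" if "i \<in> I" for i
        using \<omega> N w[OF that] that by (force simp: not_le field_simps)
      then have "(\<Sum>i\<in>I. w i * Z i \<omega>) < (\<Sum>i\<in>I. \<epsilon> / N)"
        using I False by (intro sum_strict_mono) auto
      then show False using \<omega> N by (simp add: N_def)
    qed
  qed
  then have "\<P>(\<omega> in M. \<epsilon> \<le> (\<Sum>i\<in>I. w i * Z i \<omega>)) \<le> prob (\<Union>i\<in>I. ?A i)"
    using meas I by (intro finite_measure_mono) auto
  also have "\<dots> \<le> (\<Sum>i\<in>I. prob (?A i))"
    using meas I by (intro finite_measure_subadditive_finite) auto
  also have "\<dots> \<le> (\<Sum>i\<in>I. K * exp (- (\<epsilon> / (N * V))))"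
  proof (rule sum_mono)
    fix i assume i: "i \<in> I"
    have "prob (?A i) \<le> K * exp (- ((\<epsilon> / (N * w i)) / v i))"
      using w[OF i] N \<open>\<epsilon> > 0\<close> by (intro tail i) auto
    also have "\<dots> \<le> K * exp (- (\<epsilon> / (N * V)))"
    proof -
      have "0 < w i" "0 < v i" "0 < w i * v i" using w v i by simp_all
      moreover from this have "0 < V" using V[OF i] by linarith
      ultimately have "\<epsilon> / (N * V) \<le> \<epsilon> / (N * (w i * v i))"
        using V[OF i] N \<open>\<epsilon> > 0\<close> by (intro divide_left_mono mult_left_mono mult_pos_pos) auto
      then show ?thesis using \<open>K \<ge> 0\<close> by (intro mult_left_mono) (auto simp: mult.assoc)
    qed
    finally show "prob (?A i) \<le> K * exp (- (\<epsilon> / (N * V)))" .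
  qed
  finally show ?thesis by (simp add: N_def)
qed (use \<open>\<epsilon> > 0\<close> in simp)

section \<open>Exponential against polynomial and geometric decay\<close>

text \<open>Raise \<open>u \<le> exp u\<close> at \<open>u = y / A\<close> to the power
  \<open>A\<close>.\<close>

lemma exp_minus_le_powr:
  fixes y A :: real
  assumes "y > 0" "A > 0"
  shows "exp (- y) \<le> A powr A * y powr (- A)"
proof -
  have "y / A \<le> exp (y / A)" using exp_ge_add_one_self[of "y / A"] by linarith
  then have "(y / A) powr A \<le> exp (y / A) powr A" using assms by (intro powr_mono2) auto
  also have "\<dots> = exp y" using assms by (simp add: powr_def)
  finally show ?thesis using assms
    by (simp add: powr_divide powr_minus exp_minus field_simps)
qed

text \<open>The exponent grows like \<open>q ^ k / k\<close>, faster than \<open>k * ln A\<close>,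
  so the left side times \<open>A powr k\<close> tends to 0; a convergent sequence is bounded, which
  gives one constant for all \<open>k\<close>.\<close>

lemma double_exp_decay_bound:
  fixes a q A :: real
  assumes "a > 0" "q > 1" "A > 0"
  obtains B where "B > 0" "\<And>k. real k * exp (- (a * q ^ k / real k)) \<le> B * A powr (- real k)"
proof -
  have "(\<lambda>k. real k * exp (- (a * q ^ k / real k)) * A powr real k) \<longlonglongrightarrow> 0"
    using assms by real_asymp
  then have "Bseq (\<lambda>k. real k * exp (- (a * q ^ k / real k)) * A powr real k)"
    by (intro convergent_imp_Bseq convergentI)
  then obtain B where B: "B > 0" "\<And>k. norm (real k * exp (- (a * q ^ k / real k)) * A powr real k) \<le> B"
    by (auto elim: BseqE)
  have "real k * exp (- (a * q ^ k / real k)) \<le> B * A powr (- real k)" for k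
    using B(2)[of k] assms by (simp add: powr_minus field_simps)
  with B(1) that show ?thesis by blast
qed

section \<open>Tail bounds in \<open>\<epsilon>\<close> and in \<open>k\<close>\<close>

theorem corollary5p4:
  fixes f :: "real ^ 'n \<Rightarrow> real"
    and grad_f :: "real ^ 'n \<Rightarrow> real ^ 'n"
    and g :: "real ^ 'n \<Rightarrow> ereal"
    and L \<tau> :: real
    and M :: "'w measure"
    and e :: "nat \<Rightarrow> 'w \<Rightarrow> real ^ 'n"
    and U :: "nat \<Rightarrow> real"
    and x :: "nat \<Rightarrow> 'w \<Rightarrow> real ^ 'n"
    and x0 :: "real ^ 'n"
  defines "h \<equiv> objective f g"
  assumes f_grad: "\<And>y. GDERIV f y :> grad_f y"
    and g_proper: "\<And>y. g y \<noteq> -\<infinity>"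
    and g_convex: "convex_ereal g"
    and g_lsc: "lower_semicont g"
    and S_nonempty: "argmin_set h \<noteq> {}"
    and L_pos: "L > 0"
    and tau_ge_1: "\<tau> \<ge> 1"
    and grad_Lipschitz: "\<And>y z. norm (grad_f z - grad_f y) \<le> L * norm (z - y)"
    and error_bound:
      "\<And>y. infdist y (argmin_set h)
            \<le> \<tau> * norm (y - prox g (1 / L) (y - (1 / L) *\<^sub>R grad_f y))"
    and prob: "prob_space M"
    and e_meas: "\<And>k. e k \<in> borel_measurable M"
    and x_init: "\<And>\<omega>. \<omega> \<in> space M \<Longrightarrow> x 0 \<omega> = x0"
    and x0_dom: "h x0 \<noteq> \<infinity>"
    and x_step: "\<And>k \<omega>. \<omega> \<in> space M \<Longrightarrow>
      x (Suc k) \<omega> = prox g (1 / L) (x k \<omega> - (1 / L) *\<^sub>R (grad_f (x k \<omega>) + e k \<omega>))"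
    and U_pos: "\<And>k. U k > 0"
    and U_decay: "\<And>\<beta>. 0 < \<beta> \<Longrightarrow> \<beta> < 1 \<Longrightarrow> \<exists>c>0. \<forall>k. U k \<le> c * \<beta> ^ k"
    and upper_tail: "\<And>k i \<epsilon>. \<epsilon> > 0 \<Longrightarrow>
      AE \<omega> in M. cond_prob_given M (past M e k) (\<lambda>\<omega>. e k \<omega> $ i \<ge> \<epsilon>) \<omega> \<le> exp (- (\<epsilon>\<^sup>2 / U k))"
    and lower_tail: "\<And>k i \<epsilon>. \<epsilon> > 0 \<Longrightarrow>
      AE \<omega> in M. cond_prob_given M (past M e k) (\<lambda>\<omega>. - (e k \<omega> $ i) \<ge> \<epsilon>) \<omega> \<le> exp (- (\<epsilon>\<^sup>2 / U k))"
  shows "(\<forall>k. \<forall>A>0. \<exists>C>0. \<forall>\<epsilon>>0.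
            \<P>(\<omega> in M. opt_gap h (x k \<omega>) - ereal (rate \<tau> ^ k) * opt_gap h (x 0 \<omega>) \<ge> ereal \<epsilon>)
              \<le> C * \<epsilon> powr (- A))
       \<and> (\<forall>\<epsilon>>0. \<forall>A>0. \<exists>C>0. \<forall>k.
            \<P>(\<omega> in M. opt_gap h (x k \<omega>) - ereal (rate \<tau> ^ k) * opt_gap h (x 0 \<omega>) \<ge> ereal \<epsilon>)
              \<le> C * A powr (- real k))"
proof -
  interpret prob_space M by (rule prob)
  interpret prox_gradient g f grad_f L \<tau>
  proof unfold_locales
    show "\<exists>y. g y \<noteq> \<infinity>"
      using x0_dom by (auto simp: h_def objective_def intro!: exI[of _ x0])
  qed (use assms in \<open>auto simp: h_def\<close>)
  define \<rho> where "\<rho> = rate \<tau>"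
  define n where "n = real CARD('n)"
  have \<rho>: "0 < \<rho>" "\<rho> < 1" using rate_bounds by (simp_all add: \<rho>_def)
  have n: "n > 0" by (simp add: n_def)
  obtain lam where lam: "lam > 0" "\<And>k. U k \<le> lam * \<rho> ^ k" using U_decay[OF \<rho>] by blast
  \<comment> \<open>The weight \<open>2 / L * \<rho> ^ (k - Suc i)\<close> times the scale
    \<open>n * U i\<close> is at most \<open>2 / L * n * lam * \<rho> ^ k / \<rho>\<close>, that is
    \<open>c * \<rho> ^ k\<close>; the division by \<open>\<rho>\<close> is the shift in
    \<open>Suc i\<close>.\<close>
  define c where "c = 2 / L * n * lam / \<rho>"
  have c: "c > 0" using L_pos n lam \<rho> by (simp add: c_def)
  let ?p = "\<lambda>k \<epsilon>. \<P>(\<omega> in M. opt_gap h (x k \<omega>) - ereal (rate \<tau> ^ k) * opt_gap h (x 0 \<omega>) \<ge> ereal \<epsilon>)"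
  let ?Q = "\<lambda>k \<omega>. \<Sum>i<k. 2 / L * \<rho> ^ (k - Suc i) * (norm (e i \<omega>))\<^sup>2"
  note [measurable] = e_meas
  have e_tail: "\<P>(\<omega> in M. t \<le> (norm (e k \<omega>))\<^sup>2) \<le> 2 * n * exp (- (t / (n * U k)))"
    if "t > 0" for t k
    unfolding n_def
  proof (rule prob_norm_square_ge[OF e_meas that])
    fix i and \<epsilon> :: real assume "\<epsilon> > 0"
    show "\<P>(\<omega> in M. e k \<omega> $ i \<ge> \<epsilon>) \<le> exp (- (\<epsilon>\<^sup>2 / U k))"
      by (rule prob_le_of_cond_prob_given[OF subalgebra_past[OF e_meas] _ upper_tail[OF \<open>\<epsilon> > 0\<close>]])
        measurable
    show "\<P>(\<omega> in M. - (e k \<omega> $ i) \<ge> \<epsilon>) \<le> exp (- (\<epsilon>\<^sup>2 / U k))"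
      by (rule prob_le_of_cond_prob_given[OF subalgebra_past[OF e_meas] _ lower_tail[OF \<open>\<epsilon> > 0\<close>]])
        measurable
  qed
  have main: "?p k \<epsilon> \<le> 2 * n * (real k * exp (- (\<epsilon> / (real k * (c * \<rho> ^ k)))))"
    if "\<epsilon> > 0" for k \<epsilon>
  proof -
    have "?p k \<epsilon> \<le> \<P>(\<omega> in M. \<epsilon> \<le> ?Q k \<omega>)"
    \<comment> \<open>Monotonicity asks for measurability of the larger event only: a set outside
      the sigma-algebra has measure 0 by default.\<close>
    proof (rule finite_measure_mono)
      show "{\<omega> \<in> space M. \<epsilon> \<le> ?Q k \<omega>} \<in> events" by measurable
      show "{\<omega> \<in> space M. opt_gap h (x k \<omega>) - ereal (rate \<tau> ^ k) * opt_gap h (x 0 \<omega>) \<ge> ereal \<epsilon>}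
          \<subseteq> {\<omega> \<in> space M. \<epsilon> \<le> ?Q k \<omega>}"
      proof safe
        fix \<omega> assume \<omega>: "\<omega> \<in> space M"
        assume "ereal \<epsilon> \<le> opt_gap h (x k \<omega>) - ereal (rate \<tau> ^ k) * opt_gap h (x 0 \<omega>)"
        also have "\<dots> \<le> ereal (?Q k \<omega>)"
          unfolding h_def \<rho>_def
        proof (rule prox_gradient_iterates)
          show "g (x 0 \<omega>) \<noteq> \<infinity>" using x0_dom x_init[OF \<omega>] by (auto simp: h_def objective_def)
        qed (rule x_step[OF \<omega>])
        finally show "\<epsilon> \<le> ?Q k \<omega>" by simp
      qed
    qed
    also have "\<dots> \<le> real (card {..<k}) * (2 * n) * exp (- (\<epsilon> / (real (card {..<k}) * (c * \<rho> ^ k))))"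
    proof (rule prob_weighted_sum_ge[where v="\<lambda>i. n * U i"])
      fix i assume "i \<in> {..<k}"
      then have "\<rho> ^ (k - Suc i) * \<rho> ^ i = \<rho> ^ k / \<rho>"
        using \<rho> by (simp add: power_add[symmetric] field_simps power_Suc[symmetric] del: power_Suc)
      moreover have "2 / L * \<rho> ^ (k - Suc i) * (n * U i)
          \<le> 2 / L * \<rho> ^ (k - Suc i) * (n * (lam * \<rho> ^ i))"
        using L_pos n \<rho> lam(2) by (intro mult_left_mono) auto
      moreover have "2 / L * \<rho> ^ (k - Suc i) * (n * (lam * \<rho> ^ i))
          = 2 / L * n * lam * (\<rho> ^ (k - Suc i) * \<rho> ^ i)" by simp
      ultimately show "2 / L * \<rho> ^ (k - Suc i) * (n * U i) \<le> c * \<rho> ^ k"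
        by (simp add: c_def)
    qed (use L_pos \<rho> n U_pos e_tail that in auto)
    finally show ?thesis by (simp add: mult_ac)
  qed
  show ?thesis
  proof (intro conjI allI impI)
    fix k and A :: real assume "A > 0"
    \<comment> \<open>\<open>exp_minus_le_powr\<close> at \<open>\<epsilon> / V\<close> with
      \<open>V = k * (c * \<rho> ^ k)\<close> moves \<open>V powr A\<close> into the constant. For
      \<open>k = 0\<close> this constant is 0, and adding 1 keeps \<open>C\<close> positive.\<close>
    let ?B = "2 * n * (real k * (A powr A * (real k * (c * \<rho> ^ k)) powr A))"
    have "?p k \<epsilon> \<le> (?B + 1) * \<epsilon> powr (- A)" if "\<epsilon> > 0" for \<epsilon>
    proof (cases "k = 0")
      case True
      note main[OF that, of k]
      also have "2 * n * (real k * exp (- (\<epsilon> / (real k * (c * \<rho> ^ k))))) = 0" using True by simp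
      also have "0 \<le> (?B + 1) * \<epsilon> powr (- A)" using True by simp
      finally show ?thesis .
    next
      case False
      define V where "V = real k * (c * \<rho> ^ k)"
      have V: "V > 0" using False c \<rho> by (simp add: V_def)
      have "exp (- (\<epsilon> / V)) \<le> A powr A * (\<epsilon> / V) powr (- A)"
        using that V \<open>A > 0\<close> by (intro exp_minus_le_powr) auto
      also have "\<dots> = A powr A * V powr A * \<epsilon> powr (- A)"
        using that V by (simp add: powr_divide powr_minus field_simps)
      finally have "2 * n * (real k * exp (- (\<epsilon> / V)))
          \<le> 2 * n * (real k * (A powr A * V powr A * \<epsilon> powr (- A)))"
        using n by (intro mult_left_mono) auto
      then have "?p k \<epsilon> \<le> ?B * \<epsilon> powr (- A)"
        using main[OF that, of k] by (simp add: V_def mult_ac)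
      then show ?thesis by (simp add: distrib_right add_increasing2)
    qed
    moreover have "?B + 1 > 0" using n by (intro add_nonneg_pos) auto
    ultimately show "\<exists>C>0. \<forall>\<epsilon>>0. ?p k \<epsilon> \<le> C * \<epsilon> powr (- A)" by blast
  next
    fix \<epsilon> A :: real assume "\<epsilon> > 0" "A > 0"
    obtain B where B: "B > 0"
      "\<And>k. real k * exp (- (\<epsilon> / c * (1 / \<rho>) ^ k / real k)) \<le> B * A powr (- real k)"
      using double_exp_decay_bound[of "\<epsilon> / c" "1 / \<rho>" A] \<open>\<epsilon> > 0\<close> \<open>A > 0\<close> c \<rho> by auto
    have "?p k \<epsilon> \<le> 2 * n * B * A powr (- real k)" for k
    proof -
      \<comment> \<open>This brings the exponent into the form with base
        \<open>1 / \<rho> > 1\<close>; at \<open>k = 0\<close> both sides are 0 because division by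
        0 yields 0.\<close>
      have "\<epsilon> / (real k * (c * \<rho> ^ k)) = \<epsilon> / c * (1 / \<rho>) ^ k / real k"
        by (simp add: power_one_over divide_simps)
      then have "?p k \<epsilon> \<le> 2 * n * (real k * exp (- (\<epsilon> / c * (1 / \<rho>) ^ k / real k)))"
        using main[OF \<open>\<epsilon> > 0\<close>, of k] by simp
      also have "\<dots> \<le> 2 * n * (B * A powr (- real k))"
        using B(2)[of k] n by (intro mult_left_mono) auto
      finally show ?thesis by simp
    qed
    moreover have "2 * n * B > 0" using n B by simp
    ultimately show "\<exists>C>0. \<forall>k. ?p k \<epsilon> \<le> C * A powr (- real k)" by blast
  qed
qed

end
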